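(* Let $\{X_n, n\ge 0\}$ be a countable nonhomogeneous Markov chain taking values in $S=\{1,2,\ldots\}$ with initial distribution $\mu^{(0)}=(\mu(1),\mu(2),\ldots)$ and transition matrices $P_n=(p_n(i,j))_{i,j\in S}$, $n\ge 1$, where $p_n(i,j)=\mathbb{P}(X_n=j\mid X_{n-1}=i)$. Let $f:\mathbb{R}\to\mathbb{R}$ be a function satisfying $|f(x)|\le M$ for all $x\in\mathbb{R}$, for some constant $M$. Let $P=(p(i,j))_{i,j\in S}$ be a periodic strongly ergodic stochastic matrix, and let $R$ be a constant stochastic matrix each row of which is the left eigenvector $\pi=(\pi(1),\pi(2),\ldots)$ of $P$ satisfying $\pi P=\pi$ and $\sum_{i\in S}\pi(i)=1$. Assume that $$\lim_{n\to\infty}\sup_{m\ge 0}\frac1n\sum_{k=1}^{n}\|P_{k+m}-P\|=0$$ and $$\theta:=\sum_{i\in S}\pi(i)\Big[f^2(i)-\Big(\sum_{j\in S}f(j)p(i,j)\Big)^2\Big]>0.$$ Moreover, suppose that $$\lim_{n\to\infty}\frac{\sum_{k=1}^{n}\delta(P_k)}{\sqrt n}=0.$$ Let $S_n=\sum_{k=1}^{n}f(X_k)$. Then $$\frac{S_n-E(S_n)}{\sqrt{n\theta}}\Rightarrow N(0,1)\quad\text{in distribution as } n\to\infty.$$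
   Context: For a matrix $A=(a_{ij})$ indexed by $S\times S$, $\|A\|=\sup_{i\in S}\sum_{j\in S}|a_{ij}|$. For a stochastic matrix $Q=(q(i,j))_{i,j\in S}$, $\delta(Q)=\sup_{i,k\in S}\sum_{j\in S}[q(i,j)-q(k,j)]^+$, where $[a]^+=\max\{0,a\}$. A stochastic matrix is called constant if all its rows are equal. Strong ergodicity: a sequence of stochastic matrices $\{P_n,n\ge 1\}$ is strongly ergodic (with constant stochastic matrix $R$) if for all $m\ge 0$, $\lim_{n\to\infty}\|P_{m+1}P_{m+2}\cdots P_{m+n}-R\|=0$. A single stochastic matrix $T$ is strongly ergodic if the sequence with all terms equal to $T$ is, i.e. $\|T^n-R\|\to 0$ for some constant stochastic matrix $R$ (with index set and norm those of $T$). Periodic strong ergodicity: an irreducible stochastic matrix $P$ on $S$ of period $d\ge 1$ divides $S$ into $d$ disjoint subspaces (cyclic classes) $C_0,C_1,\ldots,C_{d-1}$, and $P^d$ gives $d$ stochastic matrices $T_0,\ldots,T_{d-1}$, where $T_l$ is the restriction of $P^d$ to $C_l$. The matrix $P$ is called periodic strongly ergodic if it is irreducible of some period $d\ge 1$ and $T_l$ is strongly ergodic for every $l=0,1,\ldots,d-1$. *)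

theory Defs
  imports "HOL-Probability.Probability"
begin

text \<open>
  A matrix indexed by \<open>S \<times> S\<close> is a function \<open>'i \<Rightarrow> 'i \<Rightarrow> real\<close> of which only the entries with both
  indices in \<open>S\<close> matter; every operation below takes the index set as an argument. The restriction
  of a matrix to a subset \<open>C\<close> of \<open>S\<close> is therefore the same function, used with index set \<open>C\<close>.
\<close>

type_synonym 'i matr = "'i \<Rightarrow> 'i \<Rightarrow> real"


subsection \<open>Stochastic matrices\<close>

definition stochastic :: "'i set \<Rightarrow> 'i matr \<Rightarrow> bool" where
  "stochastic S A \<longleftrightarrow> (\<forall>i\<in>S. (\<forall>j\<in>S. 0 \<le> A i j) \<and> ((\<lambda>j. A i j) has_sum 1) S)"

definition constant_stochastic :: "'i set \<Rightarrow> 'i matr \<Rightarrow> bool" where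
  "constant_stochastic S A \<longleftrightarrow> stochastic S A \<and> (\<forall>i\<in>S. \<forall>k\<in>S. \<forall>j\<in>S. A i j = A k j)"

text \<open>
  The suprema are taken in the reals. They are only ever applied to differences of two stochastic
  matrices and to stochastic matrices respectively, where the row sums converge and are bounded
  by 2 and by 1.
\<close>

definition mat_norm :: "'i set \<Rightarrow> 'i matr \<Rightarrow> real" where
  "mat_norm S A = (SUP i\<in>S. \<Sum>\<^sub>\<infinity>j\<in>S. \<bar>A i j\<bar>)"

definition ergodic_coeff :: "'i set \<Rightarrow> 'i matr \<Rightarrow> real" where
  "ergodic_coeff S Q = (SUP (i, k)\<in>S \<times> S. \<Sum>\<^sub>\<infinity>j\<in>S. max 0 (Q i j - Q k j))"

definition mat_mult :: "'i set \<Rightarrow> 'i matr \<Rightarrow> 'i matr \<Rightarrow> 'i matr" where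
  "mat_mult S A B = (\<lambda>i j. \<Sum>\<^sub>\<infinity>k\<in>S. A i k * B k j)"

text \<open>\<open>mat_prods S P m n\<close> is the product \<open>P (m + 1) P (m + 2) \<dots> P (m + n)\<close>.\<close>

primrec mat_prods :: "'i set \<Rightarrow> (nat \<Rightarrow> 'i matr) \<Rightarrow> nat \<Rightarrow> nat \<Rightarrow> 'i matr" where
  "mat_prods S P m 0 = (\<lambda>i j. of_bool (i = j))"
| "mat_prods S P m (Suc n) = mat_mult S (mat_prods S P m n) (P (m + Suc n))"

definition mat_pow :: "'i set \<Rightarrow> 'i matr \<Rightarrow> nat \<Rightarrow> 'i matr" where
  "mat_pow S A n = mat_prods S (\<lambda>_. A) 0 n"


subsection \<open>Strong ergodicity\<close>

definition strongly_ergodic_seq :: "'i set \<Rightarrow> (nat \<Rightarrow> 'i matr) \<Rightarrow> 'i matr \<Rightarrow> bool" where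
  "strongly_ergodic_seq S P R \<longleftrightarrow>
     (\<forall>n\<ge>1. stochastic S (P n)) \<and> constant_stochastic S R \<and>
     (\<forall>m. (\<lambda>n. mat_norm S (mat_prods S P m n - R)) \<longlonglongrightarrow> 0)"

definition strongly_ergodic :: "'i set \<Rightarrow> 'i matr \<Rightarrow> bool" where
  "strongly_ergodic S T \<longleftrightarrow> (\<exists>R. strongly_ergodic_seq S (\<lambda>_. T) R)"


subsection \<open>Periodicity and periodic strong ergodicity\<close>

definition irreducible_matr :: "'i set \<Rightarrow> 'i matr \<Rightarrow> bool" where
  "irreducible_matr S A \<longleftrightarrow> (\<forall>i\<in>S. \<forall>j\<in>S. \<exists>n\<ge>1. mat_pow S A n i j > 0)"

definition has_period :: "'i set \<Rightarrow> 'i matr \<Rightarrow> nat \<Rightarrow> bool" where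
  "has_period S A d \<longleftrightarrow> (\<forall>i\<in>S. Gcd {n. n \<ge> 1 \<and> mat_pow S A n i i > 0} = d)"

text \<open>
  The cyclic classes of an irreducible stochastic matrix of period \<open>d\<close>. For such a matrix the
  family is unique up to a cyclic shift of its indices.
\<close>

definition cyclic_classes :: "'i set \<Rightarrow> 'i matr \<Rightarrow> nat \<Rightarrow> (nat \<Rightarrow> 'i set) \<Rightarrow> bool" where
  "cyclic_classes S A d C \<longleftrightarrow>
     (\<forall>l<d. C l \<noteq> {}) \<and> disjoint_family_on C {..<d} \<and> (\<Union>l<d. C l) = S \<and>
     (\<forall>l<d. \<forall>i\<in>C l. \<forall>j\<in>S. A i j > 0 \<longrightarrow> j \<in> C (Suc l mod d))"

text \<open>
  The power \<open>A ^ d\<close> is formed over \<open>S\<close>; as the \<open>l\<close>-th restricted matrix it is then used with index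
  set \<open>C l\<close>.
\<close>

definition periodic_strongly_ergodic :: "'i set \<Rightarrow> 'i matr \<Rightarrow> bool" where
  "periodic_strongly_ergodic S A \<longleftrightarrow>
     stochastic S A \<and> irreducible_matr S A \<and>
     (\<exists>d\<ge>1. has_period S A d \<and>
        (\<exists>C. cyclic_classes S A d C \<and> (\<forall>l<d. strongly_ergodic (C l) (mat_pow S A d))))"


subsection \<open>Nonhomogeneous Markov chains\<close>

text \<open>
  \<open>P n\<close>, for \<open>n \<ge> 1\<close>, governs the step from time \<open>n - 1\<close> to time \<open>n\<close>. Conditional probabilities are
  only prescribed given events of positive probability; a row of \<open>P n\<close> that belongs to a state
  not charged by \<open>X (n - 1)\<close> may be any probability vector. \<open>P 0\<close> is irrelevant.
\<close>

locale nonhom_markov_chain = prob_space M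
  for M :: "'a measure" +
  fixes S :: "'i set" and X :: "nat \<Rightarrow> 'a \<Rightarrow> 'i" and \<mu> :: "'i \<Rightarrow> real" and P :: "nat \<Rightarrow> 'i matr"
  assumes countable_states: "countable S"
    and X_measurable: "\<And>n. X n \<in> measurable M (count_space S)"
    and initial: "\<And>i. i \<in> S \<Longrightarrow> \<P>(\<omega> in M. X 0 \<omega> = i) = \<mu> i"
    and P_stochastic: "\<And>n. n \<ge> 1 \<Longrightarrow> stochastic S (P n)"
    and transition: "\<And>n i j. n \<ge> 1 \<Longrightarrow> i \<in> S \<Longrightarrow> j \<in> S \<Longrightarrow> \<P>(\<omega> in M. X (n - 1) \<omega> = i) > 0 \<Longrightarrow>
       \<P>(\<omega> in M. X n \<omega> = j \<bar> X (n - 1) \<omega> = i) = P n i j"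
    and markov: "\<And>n x j. n \<ge> 1 \<Longrightarrow> (\<And>k. k < n \<Longrightarrow> x k \<in> S) \<Longrightarrow> j \<in> S \<Longrightarrow>
       \<P>(\<omega> in M. \<forall>k<n. X k \<omega> = x k) > 0 \<Longrightarrow>
       \<P>(\<omega> in M. X n \<omega> = j \<bar> \<forall>k<n. X k \<omega> = x k) =
       \<P>(\<omega> in M. X n \<omega> = j \<bar> X (n - 1) \<omega> = x (n - 1))"

end

theory Submission
  imports Defs
begin

text \<open>
  The hypothesis on the ergodic coefficients is so strong that the limit matrix \<open>P\<close> has no room
  for any dynamics. Averaging
  \<open>\<bar>P i j - P l j\<bar> \<le> 2 \<parallel>P\<^sub>k - P\<parallel> + 2 \<delta>(P\<^sub>k)\<close> over \<open>k \<le> n\<close> and letting \<open>n\<close> grow shows that all rows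
  of \<open>P\<close> coincide (\<open>limit_rows_equal\<close>), hence equal \<open>\<pi>\<close>, and \<open>\<theta>\<close> is the variance of \<open>f\<close> under \<open>\<pi>\<close>.
  The chain thus behaves, on average, like an independent sequence with law \<open>\<pi>\<close>, and the classical
  proof of the central limit theorem by characteristic functions goes through with error terms.

  Let \<open>c\<^sub>k = E f(X\<^sub>k)\<close>, \<open>T\<^sub>n = \<Sum>k\<le>n. (f(X\<^sub>k) - c\<^sub>k)\<close> and \<open>s = t / sqrt (n \<theta>)\<close>. Given the past up to time
  \<open>k - 1\<close>, the variable \<open>X\<^sub>k\<close> has the law \<open>P\<^sub>k(i, -)\<close> with \<open>i = X\<^sub>k\<^sub>-\<^sub>1\<close>, and a second-order Taylor
  expansion gives
  \<open>E[exp (\<i> s (f(X\<^sub>k) - c\<^sub>k)) | past] = 1 - s\<^sup>2 \<theta> / 2 + error\<close>. Three things enter the error. The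
  conditional mean of \<open>f(X\<^sub>k) - c\<^sub>k\<close> is at most \<open>2 K \<delta>(P\<^sub>k)\<close>, because \<open>c\<^sub>k\<close> is an average of the row means
  of \<open>f\<close> and these differ by at most that much; it is multiplied by \<open>\<bar>s\<bar>\<close>, which is of order
  \<open>1 / sqrt n\<close>. The conditional second moment differs from \<open>\<theta>\<close> by at most \<open>5 K\<^sup>2 \<parallel>P\<^sub>k - P\<parallel>\<close>, which is
  multiplied by \<open>s\<^sup>2 / 2\<close>, of order \<open>1 / n\<close>. The Taylor remainder is of order \<open>n\<close> to the power \<open>-3/2\<close>. These
  bounds are uniform in the past (\<open>norm_expectation_iexp_approx\<close>, \<open>char_fun_one_step\<close>), so they
  telescope to a bound on \<open>E exp (\<i> s T\<^sub>n) - (1 - t\<^sup>2 / (2 n)) ^ n\<close> (\<open>char_fun_approx\<close>), and the two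
  convergence hypotheses are exactly what makes the sum of the errors vanish. Levy's continuity
  theorem concludes (\<open>clt_constant_limit\<close>).
\<close>

section \<open>Rows of stochastic matrices as probability mass functions\<close>

text \<open>
  Extending by zero outside \<open>S\<close> matters because a matrix carries no information there, while a
  mass function lives on the whole type.
\<close>

definition row_pmf :: "'i set \<Rightarrow> 'i matr \<Rightarrow> 'i \<Rightarrow> 'i pmf" where
  "row_pmf S A i = embed_pmf (\<lambda>j. if j \<in> S then A i j else 0)"

lemma pmf_row_pmf:
  assumes A: "stochastic S A" and i: "i \<in> S"
  shows "pmf (row_pmf S A i) j = (if j \<in> S then A i j else 0)"
proof -
  let ?g = "\<lambda>j. if j \<in> S then A i j else 0"
  have nonneg: "0 \<le> ?g j" for j
    using A i by (auto simp: stochastic_def)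
  have "(A i has_sum 1) S"
    using A i by (auto simp: stochastic_def)
  then have "(?g has_sum 1) UNIV"
    by (rule has_sum_cong_neutral[THEN iffD1, rotated -1]) auto
  moreover from this have abs: "Infinite_Set_Sum.abs_summable_on ?g UNIV"
    using nonneg
    by (auto simp: abs_summable_equivalent[symmetric] dest!: has_sum_imp_summable)
  ultimately have "(\<integral>\<^sup>+j. ennreal (?g j) \<partial>count_space UNIV) = 1"
    using nonneg
    by (simp add: nn_integral_conv_infsetsum infsetsum_infsum infsumI)
  then show ?thesis
    unfolding row_pmf_def using nonneg by (subst pmf_embed_pmf) auto
qed

lemma (in prob_space) norm_expectation_le:
  fixes f :: "'a \<Rightarrow> 'b::{banach, second_countable_topology}"
  assumes "AE x in M. norm (f x) \<le> B"
  shows "norm (expectation f) \<le> B"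
proof (cases "integrable M f")
  case True
  then have "norm (expectation f) \<le> expectation (\<lambda>x. norm (f x))"
    by simp
  also have "\<dots> \<le> B"
    using True assms by (intro integral_le_const) auto
  finally show ?thesis .
next
  case False
  have "AE x in M. 0 \<le> B"
    using assms by eventually_elim (use norm_ge_zero order_trans in blast)
  then show ?thesis
    using False by (simp add: not_integrable_integral_eq)
qed

lemma integrable_pmf_bounded:
  fixes h :: "'i \<Rightarrow> 'b::{banach, second_countable_topology}"
  assumes "\<And>j. norm (h j) \<le> B"
  shows "integrable (measure_pmf q) h"
  using assms by (intro measure_pmf.integrable_const_bound[where B = B]) auto

lemma expectation_row_pmf_has_sum:
  assumes A: "stochastic S A" and i: "i \<in> S" and h: "\<And>j. \<bar>h j\<bar> \<le> B"
  shows "((\<lambda>j. h j * A i j) has_sum measure_pmf.expectation (row_pmf S A i) h) S"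
proof -
  let ?q = "row_pmf S A i"
  have "integrable (measure_pmf ?q) h"
    by (rule integrable_pmf_bounded[where B = B]) (simp add: h)
  then have "integrable (count_space UNIV) (\<lambda>j. pmf ?q j * h j)"
    by (subst (asm) measure_pmf_eq_density, subst (asm) integrable_density) auto
  then have abs: "Infinite_Set_Sum.abs_summable_on (\<lambda>j. pmf ?q j * h j) UNIV"
    by (simp add: Infinite_Set_Sum.abs_summable_on_def)
  have "((\<lambda>j. pmf ?q j * h j) has_sum measure_pmf.expectation ?q h) UNIV"
    unfolding pmf_expectation_eq_infsetsum infsetsum_infsum[OF abs]
    using abs abs_summable_equivalent abs_summable_summable has_sum_infsum by blast
  then show ?thesis
    by (rule has_sum_cong_neutral[THEN iffD1, rotated -1]) (auto simp: pmf_row_pmf[OF A i])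
qed

section \<open>Row distances, the matrix norm and the ergodic coefficient\<close>

lemma stochastic_summable:
  assumes "stochastic S A" "i \<in> S"
  shows "A i summable_on S"
  using assms by (auto simp: stochastic_def intro: has_sum_imp_summable)

lemma summable_row_diff:
  assumes "stochastic S A" "stochastic S B" "i \<in> S" "k \<in> S"
  shows "(\<lambda>j. \<bar>A i j - B k j\<bar>) summable_on S"
proof (rule summable_on_comparison_test)
  show "(\<lambda>j. A i j + B k j) summable_on S"
    using assms by (intro summable_on_add stochastic_summable)
qed (use assms in \<open>auto simp: stochastic_def abs_le_iff\<close>)

text \<open>
  This bound makes the real suprema in \<open>mat_norm\<close> and \<open>ergodic_coeff\<close> meaningful: they range over
  bounded sets.
\<close>

lemma row_diff_le_2:
  assumes "stochastic S A" "stochastic S B" "i \<in> S" "k \<in> S"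
  shows "(\<Sum>\<^sub>\<infinity>j\<in>S. \<bar>A i j - B k j\<bar>) \<le> 2"
proof -
  have "(\<Sum>\<^sub>\<infinity>j\<in>S. \<bar>A i j - B k j\<bar>) \<le> (\<Sum>\<^sub>\<infinity>j\<in>S. A i j + B k j)"
    using assms by (intro infsum_mono summable_row_diff summable_on_add stochastic_summable)
      (auto simp: stochastic_def abs_le_iff)
  also have "\<dots> = 1 + 1"
    using assms by (subst infsum_add) (auto simp: stochastic_summable stochastic_def infsumI)
  finally show ?thesis by simp
qed

lemma row_diff_le_mat_norm:
  assumes "stochastic S A" "stochastic S B" "i \<in> S"
  shows "(\<Sum>\<^sub>\<infinity>j\<in>S. \<bar>A i j - B i j\<bar>) \<le> mat_norm S (A - B)"
  unfolding mat_norm_def using assms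
  by (intro cSUP_upper2[where x = i] bdd_aboveI[where M = 2]) (auto intro: row_diff_le_2)

lemma mat_norm_diff_bounds:
  assumes "stochastic S A" "stochastic S B" "S \<noteq> {}"
  shows "0 \<le> mat_norm S (A - B)" "mat_norm S (A - B) \<le> 2"
proof -
  obtain i where i: "i \<in> S" using assms by auto
  have "0 \<le> (\<Sum>\<^sub>\<infinity>j\<in>S. \<bar>A i j - B i j\<bar>)" by (intro infsum_nonneg) auto
  then show "0 \<le> mat_norm S (A - B)" using row_diff_le_mat_norm[OF assms(1,2) i] by linarith
  show "mat_norm S (A - B) \<le> 2"
    unfolding mat_norm_def using assms by (intro cSUP_least) (auto intro: row_diff_le_2)
qed

text \<open>
  The absolute value is the sum of the two positive parts of \<open>A i j - A k j\<close> and of its negative, and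
  the sum of each over \<open>j\<close> is bounded by the coefficient; hence the factor 2.
\<close>

lemma row_diff_le_ergodic_coeff:
  assumes A: "stochastic S A" and i: "i \<in> S" and k: "k \<in> S"
  shows "(\<Sum>\<^sub>\<infinity>j\<in>S. \<bar>A i j - A k j\<bar>) \<le> 2 * ergodic_coeff S A"
proof -
  have summ: "(\<lambda>j. max 0 (A i j - A k j)) summable_on S" if "i \<in> S" "k \<in> S" for i k
    by (rule summable_on_comparison_test[OF summable_row_diff[OF A A that]]) auto
  have le: "(\<Sum>\<^sub>\<infinity>j\<in>S. max 0 (A i j - A k j)) \<le> ergodic_coeff S A" if "i \<in> S" "k \<in> S" for i k
  proof -
    have "(\<Sum>\<^sub>\<infinity>j\<in>S. max 0 (A i j - A k j)) \<le> 2" if "i \<in> S" "k \<in> S" for i k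
      using infsum_mono[OF summ[OF that] summable_row_diff[OF A A that]] row_diff_le_2[OF A A that]
      by (smt (verit) max_def)
    then show ?thesis
      unfolding ergodic_coeff_def using that
      by (intro cSUP_upper2[where x = "(i, k)"] bdd_aboveI[where M = 2]) auto
  qed
  have "(\<Sum>\<^sub>\<infinity>j\<in>S. \<bar>A i j - A k j\<bar>)
      = (\<Sum>\<^sub>\<infinity>j\<in>S. max 0 (A i j - A k j) + max 0 (A k j - A i j))"
    by (intro infsum_cong) (auto simp: max_def)
  also have "\<dots> = (\<Sum>\<^sub>\<infinity>j\<in>S. max 0 (A i j - A k j)) + (\<Sum>\<^sub>\<infinity>j\<in>S. max 0 (A k j - A i j))"
    by (intro infsum_add summ i k)
  also have "\<dots> \<le> 2 * ergodic_coeff S A"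
    using le[OF i k] le[OF k i] by simp
  finally show ?thesis .
qed

lemma expectation_row_pmf_diff:
  assumes A: "stochastic S A" and B: "stochastic S B" and i: "i \<in> S" and k: "k \<in> S"
    and h: "\<And>j. \<bar>h j\<bar> \<le> C"
  shows "\<bar>measure_pmf.expectation (row_pmf S A i) h - measure_pmf.expectation (row_pmf S B k) h\<bar>
    \<le> C * (\<Sum>\<^sub>\<infinity>j\<in>S. \<bar>A i j - B k j\<bar>)"
proof -
  let ?D = "measure_pmf.expectation (row_pmf S A i) h - measure_pmf.expectation (row_pmf S B k) h"
  have "((\<lambda>j. h j * A i j - h j * B k j) has_sum ?D) S"
  proof -
    have "((\<lambda>j. - (h j * B k j)) has_sum - measure_pmf.expectation (row_pmf S B k) h) S"
      using expectation_row_pmf_has_sum[OF B k h] by (subst has_sum_uminus) simp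
    from has_sum_add[OF expectation_row_pmf_has_sum[OF A i h] this] show ?thesis
      by simp
  qed
  then have D: "((\<lambda>j. h j * (A i j - B k j)) has_sum ?D) S"
    by (simp add: algebra_simps)
  have s: "((\<lambda>j. C * \<bar>A i j - B k j\<bar>) has_sum C * (\<Sum>\<^sub>\<infinity>j\<in>S. \<bar>A i j - B k j\<bar>)) S"
    by (intro has_sum_cmult_right has_sum_infsum summable_row_diff assms)
  have *: "\<bar>h j * (A i j - B k j)\<bar> \<le> C * \<bar>A i j - B k j\<bar>" for j
    using h[of j] by (simp add: abs_mult mult_right_mono)
  have s': "((\<lambda>j. - (C * \<bar>A i j - B k j\<bar>)) has_sum - (C * (\<Sum>\<^sub>\<infinity>j\<in>S. \<bar>A i j - B k j\<bar>))) S"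
    using s by (subst has_sum_uminus) simp
  have "?D \<le> C * (\<Sum>\<^sub>\<infinity>j\<in>S. \<bar>A i j - B k j\<bar>)"
    using * by (intro has_sum_mono[OF D s]) (auto simp: abs_le_iff)
  moreover have "- (C * (\<Sum>\<^sub>\<infinity>j\<in>S. \<bar>A i j - B k j\<bar>)) \<le> ?D"
    using * by (intro has_sum_mono[OF s' D]) (auto simp: abs_le_iff minus_le_iff)
  ultimately show ?thesis
    by (auto simp: abs_le_iff)
qed

section \<open>Taylor expansion of the characteristic function of one step\<close>

text \<open>
  Here \<open>q\<close> is the law of the next state given the past, \<open>p\<close> the limiting law, and \<open>c\<close> the
  unconditional mean at which the next term is centred. Writing \<open>m\<close> and \<open>g\<close> for the means of \<open>h\<close> under
  \<open>p\<close> and \<open>q\<close>, the second moment of \<open>h - c\<close> under \<open>q\<close> exceeds \<open>\<theta>\<close> by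
  \<open>(E\<^sub>q h\<^sup>2 - E\<^sub>p h\<^sup>2) + (c - m)\<^sup>2 + 2 c (m - g)\<close>, and these summands are bounded by
  \<open>K\<^sup>2 \<epsilon>\<close>, \<open>2 K\<^sup>2 \<epsilon>\<close> and \<open>2 K\<^sup>2 \<epsilon>\<close>. The first moment has its own parameter \<open>\<delta>\<close>: it is scaled by \<open>s\<close> only,
  not by \<open>s\<^sup>2\<close>, and closeness of \<open>q\<close> to \<open>p\<close> would be too weak there.
\<close>

lemma norm_expectation_iexp_approx:
  fixes h :: "'i \<Rightarrow> real" and p q :: "'i pmf"
  assumes h: "\<And>j. \<bar>h j\<bar> \<le> K" and c: "\<bar>c\<bar> \<le> K"
    and near: "\<bar>measure_pmf.expectation q h - c\<bar> \<le> \<delta>"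
    and mean: "\<bar>c - measure_pmf.expectation p h\<bar> \<le> K * \<epsilon>"
    and close: "\<And>u B. (\<And>j. \<bar>u j\<bar> \<le> B) \<Longrightarrow>
      \<bar>measure_pmf.expectation q u - measure_pmf.expectation p u\<bar> \<le> B * \<epsilon>"
    and \<theta>: "\<theta> = measure_pmf.expectation p (\<lambda>j. (h j)\<^sup>2) - (measure_pmf.expectation p h)\<^sup>2"
  shows "norm (measure_pmf.expectation q (\<lambda>j. iexp (s * (h j - c))) - of_real (1 - s\<^sup>2 * \<theta> / 2))
    \<le> \<bar>s\<bar> * \<delta> + s\<^sup>2 / 2 * (5 * K\<^sup>2 * \<epsilon>) + \<bar>s\<bar> ^ 3 * (2 * K) ^ 3 / 6"
proof -
  define m where "m = measure_pmf.expectation p h"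
  define g where "g = measure_pmf.expectation q h"
  define v where "v = measure_pmf.expectation q (\<lambda>j. (h j - c)\<^sup>2)"
  have K: "0 \<le> K" using c by linarith
  have h2: "\<bar>(h j)\<^sup>2\<bar> \<le> K\<^sup>2" for j
    using h[of j] by (simp add: abs_le_square_iff[symmetric])
  have int[simp]: "integrable (measure_pmf r) h" "integrable (measure_pmf r) (\<lambda>j. (h j)\<^sup>2)" for r
    using h h2 integrable_pmf_bounded[of h K r] integrable_pmf_bounded[of "\<lambda>j. (h j)\<^sup>2" "K\<^sup>2" r]
    by simp_all
  have m: "\<bar>m\<bar> \<le> K"
    unfolding m_def using measure_pmf.norm_expectation_le[of h K p] h by simp
  have v: "v = measure_pmf.expectation q (\<lambda>j. (h j)\<^sup>2) - 2 * c * g + c\<^sup>2"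
    unfolding v_def g_def power2_diff by (simp add: mult.assoc mult.commute)
  have "v - \<theta> = (measure_pmf.expectation q (\<lambda>j. (h j)\<^sup>2) - measure_pmf.expectation p (\<lambda>j. (h j)\<^sup>2))
      + (c - m)\<^sup>2 + 2 * c * (m - g)"
    unfolding v \<theta> m_def[symmetric] by (simp add: power2_eq_square algebra_simps)
  moreover have "\<bar>(c - m)\<^sup>2\<bar> \<le> 2 * K * (K * \<epsilon>)"
  proof -
    have "\<bar>c - m\<bar> * \<bar>c - m\<bar> \<le> (2 * K) * (K * \<epsilon>)"
      using c m mean by (intro mult_mono) (auto simp: m_def)
    then show ?thesis by (simp add: power2_eq_square abs_mult)
  qed
  moreover have "\<bar>2 * c * (m - g)\<bar> \<le> 2 * K * (K * \<epsilon>)"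
  proof -
    have "\<bar>m - g\<bar> \<le> K * \<epsilon>"
      using close[OF h] by (simp add: m_def g_def abs_minus_commute)
    then have "(2 * \<bar>c\<bar>) * \<bar>m - g\<bar> \<le> (2 * K) * (K * \<epsilon>)"
      using c K by (intro mult_mono) auto
    then show ?thesis by (simp add: abs_mult)
  qed
  moreover have "\<bar>measure_pmf.expectation q (\<lambda>j. (h j)\<^sup>2) - measure_pmf.expectation p (\<lambda>j. (h j)\<^sup>2)\<bar> \<le> K\<^sup>2 * \<epsilon>"
    by (rule close) (rule h2)
  ultimately have "\<bar>v - \<theta>\<bar> \<le> K\<^sup>2 * \<epsilon> + 2 * K * (K * \<epsilon>) + 2 * K * (K * \<epsilon>)"
    by linarith
  also have "\<dots> = 5 * K\<^sup>2 * \<epsilon>"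
    by (simp add: power2_eq_square)
  finally have v\<theta>: "\<bar>v - \<theta>\<bar> \<le> 5 * K\<^sup>2 * \<epsilon>" .
  let ?T = "\<lambda>j. 1 + \<i> * of_real (s * (h j - c)) - of_real ((s * (h j - c))\<^sup>2 / 2) :: complex"
  have iT: "norm (iexp x - (1 + \<i> * of_real x - of_real (x\<^sup>2 / 2))) \<le> \<bar>x\<bar> ^ 3 / 6" for x :: real
    using iexp_approx1[of x 2] by (simp add: numeral_eq_Suc atMost_Suc field_simps)
  have x: "norm (iexp (s * (h j - c)) - ?T j) \<le> \<bar>s\<bar> ^ 3 * (2 * K) ^ 3 / 6" for j
  proof -
    have "\<bar>h j - c\<bar> \<le> 2 * K" using h[of j] c by linarith
    then have "\<bar>h j - c\<bar> ^ 3 \<le> (2 * K) ^ 3" by (intro power_mono) auto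
    then have "\<bar>s * (h j - c)\<bar> ^ 3 / 6 \<le> \<bar>s\<bar> ^ 3 * (2 * K) ^ 3 / 6"
      unfolding abs_mult power_mult_distrib
      by (intro divide_right_mono mult_left_mono) auto
    then show ?thesis using iT[of "s * (h j - c)"] by (rule order_trans[rotated])
  qed
  have intx: "integrable (measure_pmf q) (\<lambda>j. iexp (s * (h j - c)))"
    by (rule integrable_pmf_bounded[where B = 1]) simp
  have hc: "integrable (measure_pmf q) (\<lambda>j. h j - c)" "integrable (measure_pmf q) (\<lambda>j. (h j - c)\<^sup>2)"
    unfolding power2_diff by auto
  have T: "has_bochner_integral (measure_pmf q) ?T
      (1 + \<i> * of_real (s * (g - c)) - of_real (s\<^sup>2 * v / 2))"
  proof -
    have "has_bochner_integral (measure_pmf q) (\<lambda>j. s * (h j - c)) (s * (g - c))"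
      using hc by (simp add: has_bochner_integral_iff g_def)
    moreover have "has_bochner_integral (measure_pmf q) (\<lambda>j. (s * (h j - c))\<^sup>2 / 2) (s\<^sup>2 * v / 2)"
      using hc by (simp add: has_bochner_integral_iff v_def power_mult_distrib)
    moreover have "has_bochner_integral (measure_pmf q) (\<lambda>j. 1 :: complex) 1"
      by (simp add: has_bochner_integral_iff)
    ultimately show ?thesis
      using has_bochner_integral_of_real[of "measure_pmf q" "\<lambda>j. s * (h j - c)", where 'a = complex]
        has_bochner_integral_of_real[of "measure_pmf q" "\<lambda>j. (s * (h j - c))\<^sup>2 / 2", where 'a = complex]
      by (intro has_bochner_integral_diff has_bochner_integral_add has_bochner_integral_mult_right) blast+
  qed
  then have ET: "measure_pmf.expectation q ?T = 1 + \<i> * of_real (s * (g - c)) - of_real (s\<^sup>2 * v / 2)"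
    and intT: "integrable (measure_pmf q) ?T"
    by (auto simp: has_bochner_integral_iff)
  have "measure_pmf.expectation q (\<lambda>j. iexp (s * (h j - c))) - of_real (1 - s\<^sup>2 * \<theta> / 2)
      = measure_pmf.expectation q (\<lambda>j. iexp (s * (h j - c)) - ?T j)
        + \<i> * of_real (s * (g - c)) - of_real (s\<^sup>2 / 2 * (v - \<theta>))" (is "?lhs = ?E3 + ?E1 - ?E2")
    by (subst Bochner_Integration.integral_diff[OF intx intT], unfold ET)
      (simp add: field_simps)
  then have "norm ?lhs \<le> norm ?E3 + norm ?E1 + norm ?E2"
    by (simp only:) (intro norm_triangle_le_diff norm_triangle_le add_right_mono order_refl)
  moreover have "norm ?E3 \<le> \<bar>s\<bar> ^ 3 * (2 * K) ^ 3 / 6"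
    using x by (intro measure_pmf.norm_expectation_le AE_I2)
  moreover have "norm ?E1 \<le> \<bar>s\<bar> * \<delta>"
    using near by (simp add: norm_mult abs_mult g_def mult_left_mono flip: of_real_diff)
  moreover have "norm ?E2 \<le> s\<^sup>2 / 2 * (5 * K\<^sup>2 * \<epsilon>)"
    unfolding norm_of_real abs_mult using v\<theta> by (intro mult_mono) auto
  ultimately show ?thesis
    by linarith
qed

section \<open>The Markov property for bounded functions of the history\<close>

text \<open>
  The only obstacle to regarding the law of \<open>H\<close> as a mass function is that almost every point must
  be an atom; as \<open>H\<close> takes countably many values, the non-atoms among them form a null set.
\<close>

lemma (in prob_space) pmf_of_countably_valued:
  assumes H: "H \<in> measurable M (count_space A)" and A: "countable A"
  shows "\<exists>p. measure_pmf p = distr M (count_space UNIV) H \<and> set_pmf p \<subseteq> A \<and>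
    (\<forall>x. pmf p x = \<P>(\<omega> in M. H \<omega> = x))"
proof -
  let ?D = "distr M (count_space UNIV) H"
  have H'[measurable]: "H \<in> measurable M (count_space UNIV)"
    by (rule measurable_compose[OF H]) simp
  interpret D: prob_space ?D
    by (rule prob_space_distr) simp
  have in_A: "AE x in ?D. x \<in> A"
    using measurable_space[OF H] by (subst AE_distr_iff) auto
  have "AE x in ?D. \<forall>y\<in>A. measure ?D {y} = 0 \<longrightarrow> x \<noteq> y"
  proof (subst AE_ball_countable[OF A], intro ballI)
    fix y
    show "AE x in ?D. measure ?D {y} = 0 \<longrightarrow> x \<noteq> y"
    proof (cases "measure ?D {y} = 0")
      case True
      then have "{y} \<in> null_sets ?D"
        by (auto simp: D.emeasure_eq_measure)
      then show ?thesis
        by (auto dest: AE_not_in)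
    qed simp
  qed
  with in_A have "AE x in ?D. measure ?D {x} \<noteq> 0"
    by eventually_elim auto
  then have p: "measure_pmf (Abs_pmf ?D) = ?D"
    by (intro Abs_pmf_inverse) (auto simp: D.prob_space_axioms)
  have pmf: "pmf (Abs_pmf ?D) x = \<P>(\<omega> in M. H \<omega> = x)" for x
    by (simp add: pmf.rep_eq p measure_distr vimage_def Int_def conj_commute)
  have "AE x in measure_pmf (Abs_pmf ?D). x \<in> A"
    using in_A unfolding p .
  then have "set_pmf (Abs_pmf ?D) \<subseteq> A"
    by (auto simp: AE_measure_pmf_iff)
  with p pmf show ?thesis
    by blast
qed

lemma complex_expectation_bind_pmf:
  fixes F :: "'b \<Rightarrow> complex"
  assumes F: "\<And>x. norm (F x) \<le> B"
  shows "measure_pmf.expectation (bind_pmf p N) F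
    = measure_pmf.expectation p (\<lambda>x. measure_pmf.expectation (N x) F)"
proof -
  have real: "measure_pmf.expectation (bind_pmf p N) G
      = measure_pmf.expectation p (\<lambda>x. measure_pmf.expectation (N x) G)"
    if "\<And>x. \<bar>G x\<bar> \<le> B" for G :: "'b \<Rightarrow> real"
    unfolding measure_pmf_bind using that
    by (intro integral_bind[where K = "count_space UNIV" and B' = 1 and B = B])
      (auto simp: measure_pmf.emeasure_space_1 measure_pmf.finite_measure
        intro: measure_pmf_in_subprob_algebra)
  have int: "integrable (measure_pmf q) F" for q
    using F by (rule integrable_pmf_bounded)
  have int': "integrable (measure_pmf q) (\<lambda>x. measure_pmf.expectation (N x) F)" for q
    using F by (intro integrable_pmf_bounded[where B = B] measure_pmf.norm_expectation_le AE_I2)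
  have Re: "\<bar>Re (F x)\<bar> \<le> B" and Im: "\<bar>Im (F x)\<bar> \<le> B" for x
    using F[of x] abs_Re_le_cmod[of "F x"] abs_Im_le_cmod[of "F x"] by linarith+
  show ?thesis
    by (rule complex_eqI)
      (simp_all only: integral_Re[OF int, symmetric] integral_Re[OF int', symmetric]
        integral_Im[OF int, symmetric] integral_Im[OF int', symmetric] real[OF Re] real[OF Im])
qed

context nonhom_markov_chain
begin

lemma X_in_S: "\<omega> \<in> space M \<Longrightarrow> X n \<omega> \<in> S"
  using measurable_space[OF X_measurable] by simp

lemma X_borel[measurable]: "X n \<in> measurable M (count_space UNIV)"
  by (rule measurable_compose[OF X_measurable]) simp

text \<open>
  Recording the past as a list makes it a single random variable with values in the countable set
  \<open>lists S\<close>.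
\<close>

definition hist :: "nat \<Rightarrow> 'a \<Rightarrow> 'i list" where
  "hist n \<omega> = map (\<lambda>k. X k \<omega>) [0..<n]"

lemma hist_eq_iff: "hist n \<omega> = h \<longleftrightarrow> length h = n \<and> (\<forall>k<n. X k \<omega> = h ! k)"
  by (auto simp: hist_def list_eq_iff_nth_eq)

lemma hist_measurable: "hist n \<in> measurable M (count_space (lists S))"
proof (rule measurable_count_space_eq_countable[THEN iffD2])
  show "countable (lists S)"
    by (simp add: countable_states)
  have "hist n -` {h} \<inter> space M \<in> sets M" for h
  proof -
    have "hist n -` {h} \<inter> space M = {\<omega>\<in>space M. length h = n \<and> (\<forall>k\<in>{..<n}. X k \<omega> = h ! k)}"
      using hist_eq_iff[of n _ h] by blast
    also have "\<dots> \<in> sets M" by measurable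
    finally show ?thesis .
  qed
  then show "hist n \<in> space M \<rightarrow> lists S \<and> (\<forall>h\<in>lists S. hist n -` {h} \<inter> space M \<in> sets M)"
    by (auto simp: hist_def X_in_S)
qed

text \<open>
  If the history \<open>h\<close> has positive probability, so has its last state, and the Markov and transition
  assumptions apply; otherwise both sides vanish. The identity of joint probabilities is thus free
  of any positivity condition.
\<close>

lemma prob_hist_step:
  assumes n: "n \<ge> 1" and h: "h \<in> lists S" "length h = n" and j: "j \<in> S"
  shows "\<P>(\<omega> in M. hist n \<omega> = h \<and> X n \<omega> = j) = \<P>(\<omega> in M. hist n \<omega> = h) * P n (last h) j"
proof (cases "\<P>(\<omega> in M. hist n \<omega> = h) > 0")
  case True
  have hS: "h ! k \<in> S" if "k < n" for k
    using that h by auto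
  have last: "last h = h ! (n - 1)"
    using n h by (subst last_conv_nth) auto
  have eq: "\<P>(\<omega> in M. hist n \<omega> = h) = \<P>(\<omega> in M. \<forall>k<n. X k \<omega> = h ! k)"
    by (intro arg_cong[where f = prob]) (auto simp: hist_eq_iff h)
  have "\<P>(\<omega> in M. \<forall>k<n. X k \<omega> = h ! k) \<le> \<P>(\<omega> in M. X (n - 1) \<omega> = h ! (n - 1))"
    using n by (intro finite_measure_mono) auto
  then have pos: "\<P>(\<omega> in M. X (n - 1) \<omega> = h ! (n - 1)) > 0"
    using True eq by simp
  have "P n (last h) j = \<P>(\<omega> in M. X n \<omega> = j \<bar> \<forall>k<n. X k \<omega> = h ! k)"
    using markov[OF n, of "\<lambda>k. h ! k" j] transition[OF n _ j pos] True eq hS n j last by simp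
  also have "\<dots> = \<P>(\<omega> in M. X n \<omega> = j \<and> (\<forall>k<n. X k \<omega> = h ! k)) / \<P>(\<omega> in M. \<forall>k<n. X k \<omega> = h ! k)"
    by (simp add: cond_prob_def)
  also have "\<P>(\<omega> in M. X n \<omega> = j \<and> (\<forall>k<n. X k \<omega> = h ! k)) = \<P>(\<omega> in M. hist n \<omega> = h \<and> X n \<omega> = j)"
    by (intro arg_cong[where f = prob]) (auto simp: hist_eq_iff h)
  finally show ?thesis
    using True eq by (simp add: field_simps)
next
  case False
  then have 0: "\<P>(\<omega> in M. hist n \<omega> = h) = 0"
    using measure_nonneg[of M] by (simp add: less_le)
  have "\<P>(\<omega> in M. hist n \<omega> = h \<and> X n \<omega> = j) \<le> \<P>(\<omega> in M. hist n \<omega> = h)"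
    using measurable_sets[OF hist_measurable, of "{h}" n] h
    by (intro finite_measure_mono) (auto simp: vimage_def Int_def conj_commute)
  then show ?thesis
    using 0 measure_nonneg[of M] by (simp add: antisym)
qed

text \<open>
  The tower property in the form needed below: \<open>X n\<close> may be integrated out against the row of \<open>P n\<close>
  at the previous state while the whole history stays fixed. It says that the joint law of the
  history and \<open>X n\<close> is obtained by first drawing the history and then the new state from that row,
  which is checked on atoms.
\<close>

lemma expectation_step:
  fixes F :: "'i list \<Rightarrow> 'i \<Rightarrow> complex"
  assumes n: "n \<ge> 1" and F: "\<And>h j. norm (F h j) \<le> B"
  shows "expectation (\<lambda>\<omega>. F (hist n \<omega>) (X n \<omega>))
    = expectation (\<lambda>\<omega>. measure_pmf.expectation (row_pmf S (P n) (X (n - 1) \<omega>)) (F (hist n \<omega>)))"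
proof -
  let ?row = "row_pmf S (P n)"
  have stoch: "stochastic S (P n)"
    using n by (rule P_stochastic)
  obtain p where p: "measure_pmf p = distr M (count_space UNIV) (hist n)" "set_pmf p \<subseteq> lists S"
    and pmf_p: "\<And>x. pmf p x = \<P>(\<omega> in M. hist n \<omega> = x)"
    using pmf_of_countably_valued[OF hist_measurable[of n] countable_lists[OF countable_states]] by blast
  have hist[measurable]: "hist n \<in> measurable M (count_space UNIV)"
    by (rule measurable_compose[OF hist_measurable]) simp
  have HX: "(\<lambda>\<omega>. (hist n \<omega>, X n \<omega>)) \<in> measurable M (count_space (lists S \<times> S))"
    using measurable_Pair[OF hist_measurable X_measurable, of n n]
    by (simp add: pair_measure_countable countable_states)
  obtain J where J: "measure_pmf J = distr M (count_space UNIV) (\<lambda>\<omega>. (hist n \<omega>, X n \<omega>))"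
      "set_pmf J \<subseteq> lists S \<times> S"
    and pmf_J: "\<And>x. pmf J x = \<P>(\<omega> in M. (hist n \<omega>, X n \<omega>) = x)"
    using pmf_of_countably_valued[OF HX countable_SIGMA[OF countable_lists[OF countable_states] countable_states]] by blast
  have HX'[measurable]: "(\<lambda>\<omega>. (hist n \<omega>, X n \<omega>)) \<in> measurable M (count_space UNIV)"
    by (rule measurable_compose[OF HX]) simp
  have len: "length h = n" if "h \<in> set_pmf p" for h
  proof -
    have "AE x in measure_pmf p. length x = n"
      unfolding p(1) by (subst AE_distr_iff) (auto simp: hist_def)
    then show ?thesis using that by (simp add: AE_measure_pmf_iff)
  qed
  have J_eq: "J = bind_pmf p (\<lambda>h. map_pmf (Pair h) (?row (last h)))"
  proof (rule pmf_eqI)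
    fix x :: "'i list \<times> 'i"
    obtain h j where x: "x = (h, j)" by (cases x)
    have "pmf (bind_pmf p (\<lambda>h. map_pmf (Pair h) (?row (last h)))) (h, j)
        = measure_pmf.expectation p (\<lambda>h'. pmf (?row (last h)) j * indicator {h} h')"
      unfolding pmf_bind
    proof (intro Bochner_Integration.integral_cong refl)
      fix h'
      show "pmf (map_pmf (Pair h') (?row (last h'))) (h, j) = pmf (?row (last h)) j * indicator {h} h'"
        by (cases "h' = h") (auto simp: pmf_map_inj' inj_on_def pmf_eq_0_set_pmf)
    qed
    also have "\<dots> = pmf (?row (last h)) j * pmf p h"
      by (simp add: pmf.rep_eq)
    also have "\<dots> = pmf J (h, j)"
    proof (cases "h \<in> set_pmf p \<and> j \<in> S")
      case True
      then have h: "h \<in> lists S" "length h = n" using p(2) len by auto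
      then have "last h \<in> S" using n by (cases h rule: rev_cases) auto
      then show ?thesis
        using prob_hist_step[OF n h, of j] True by (simp add: pmf_J pmf_p pmf_row_pmf[OF stoch])
    next
      case False
      have "pmf J (h, j) \<le> pmf p h"
        unfolding pmf_J pmf_p by (intro finite_measure_mono) auto
      moreover have "pmf J (h, j) = 0" if "j \<notin> S"
        using J(2) that by (auto simp: pmf_eq_0_set_pmf)
      moreover have "pmf (?row (last h)) j * pmf p h = 0" if "j \<notin> S"
      proof (cases "h \<in> set_pmf p")
        case True
        then have "h \<in> lists S" "length h = n" using p(2) len by auto
        then have "last h \<in> S" using n by (cases h rule: rev_cases) auto
        then show ?thesis using that by (simp add: pmf_row_pmf[OF stoch])
      qed (simp add: pmf_eq_0_set_pmf)
      ultimately show ?thesis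
        using False by (auto simp: pmf_eq_0_set_pmf[THEN iffD2] antisym)
    qed
    finally show "pmf J x = pmf (bind_pmf p (\<lambda>h. map_pmf (Pair h) (?row (last h)))) x"
      by (simp add: x)
  qed
  have "expectation (\<lambda>\<omega>. F (hist n \<omega>) (X n \<omega>)) = measure_pmf.expectation J (\<lambda>(h, j). F h j)"
    unfolding J(1) by (subst integral_distr) auto
  also have "\<dots> = measure_pmf.expectation p (\<lambda>h. measure_pmf.expectation (?row (last h)) (F h))"
    unfolding J_eq by (subst complex_expectation_bind_pmf[where B = B]) (auto simp: F)
  also have "\<dots> = expectation (\<lambda>\<omega>. measure_pmf.expectation (?row (last (hist n \<omega>))) (F (hist n \<omega>)))"
    unfolding p(1) by (subst integral_distr) auto
  finally show ?thesis
    using n by (simp add: hist_def last_map)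
qed

section \<open>Characteristic functions of the centred sums\<close>

lemma integrable_of_X:
  fixes u :: "'i \<Rightarrow> 'b::{banach, second_countable_topology}"
  assumes "\<And>j. norm (u j) \<le> B"
  shows "integrable M (\<lambda>\<omega>. u (X n \<omega>))"
  using assms
  by (intro integrable_const_bound[where B = B] measurable_compose[OF X_borel]) auto

lemma expectation_X_eq:
  fixes h :: "'i \<Rightarrow> real"
  assumes n: "n \<ge> 1" and h: "\<And>j. \<bar>h j\<bar> \<le> K"
  shows "expectation (\<lambda>\<omega>. h (X n \<omega>))
    = expectation (\<lambda>\<omega>. measure_pmf.expectation (row_pmf S (P n) (X (n - 1) \<omega>)) h)"
proof -
  have "complex_of_real (expectation (\<lambda>\<omega>. h (X n \<omega>))) = expectation (\<lambda>\<omega>. complex_of_real (h (X n \<omega>)))"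
    by simp
  also have "\<dots> = expectation (\<lambda>\<omega>. measure_pmf.expectation (row_pmf S (P n) (X (n - 1) \<omega>))
      (\<lambda>j. complex_of_real (h j)))"
    using expectation_step[OF n, of "\<lambda>_ j. complex_of_real (h j)" K] h by simp
  also have "\<dots> = complex_of_real
      (expectation (\<lambda>\<omega>. measure_pmf.expectation (row_pmf S (P n) (X (n - 1) \<omega>)) h))"
    by simp
  finally show ?thesis
    by (simp only: of_real_eq_iff)
qed

text \<open>
  The mean of \<open>h (X n)\<close> is an average of the row means of \<open>h\<close>. With \<open>m\<close> the limiting mean this bounds
  the error of the centring by the matrix norm; with \<open>m\<close> the mean along a fixed row it bounds the
  conditional mean of the centred term by the ergodic coefficient.
\<close>

lemma expectation_X_near:
  fixes h :: "'i \<Rightarrow> real"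
  assumes n: "n \<ge> 1" and h: "\<And>j. \<bar>h j\<bar> \<le> K"
    and near: "\<And>i. i \<in> S \<Longrightarrow> \<bar>measure_pmf.expectation (row_pmf S (P n) i) h - m\<bar> \<le> b"
  shows "\<bar>expectation (\<lambda>\<omega>. h (X n \<omega>)) - m\<bar> \<le> b"
proof -
  let ?g = "\<lambda>i. measure_pmf.expectation (row_pmf S (P n) i) h"
  have "\<bar>?g i\<bar> \<le> K" for i
    using measure_pmf.norm_expectation_le[of h K "row_pmf S (P n) i"] h by simp
  then have "integrable M (\<lambda>\<omega>. ?g (X (n - 1) \<omega>))"
    by (intro integrable_of_X[where B = K]) simp
  then have "expectation (\<lambda>\<omega>. h (X n \<omega>)) - m = expectation (\<lambda>\<omega>. ?g (X (n - 1) \<omega>) - m)"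
    by (subst expectation_X_eq[OF n h]) (simp_all add: prob_space)
  also have "\<bar>\<dots>\<bar> \<le> b"
    using norm_expectation_le[of "\<lambda>\<omega>. ?g (X (n - 1) \<omega>) - m" b] near[OF X_in_S] by simp
  finally show ?thesis .
qed

text \<open>
  The factor \<open>exp (\<i> s T\<^sub>n\<^sub>-\<^sub>1)\<close> is a function \<open>W\<close> of the history and has modulus 1. Integrating out \<open>X n\<close>
  turns the difference into the mean of \<open>W\<close> times the one-row error, which is bounded uniformly over
  the rows.
\<close>

lemma char_fun_one_step:
  fixes h :: "'i \<Rightarrow> real"
  defines "c \<equiv> \<lambda>k. expectation (\<lambda>\<omega>. h (X k \<omega>))"
  defines "T \<equiv> \<lambda>n \<omega>. \<Sum>k=1..n. h (X k \<omega>) - c k"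
  assumes Q: "constant_stochastic S Q" and i0: "i0 \<in> S" and h: "\<And>j. \<bar>h j\<bar> \<le> K"
    and \<theta>: "\<theta> = measure_pmf.expectation (row_pmf S Q i0) (\<lambda>j. (h j)\<^sup>2)
      - (measure_pmf.expectation (row_pmf S Q i0) h)\<^sup>2"
    and n: "n \<ge> 1"
  shows "norm (expectation (\<lambda>\<omega>. iexp (s * T n \<omega>))
      - of_real (1 - s\<^sup>2 * \<theta> / 2) * expectation (\<lambda>\<omega>. iexp (s * T (n - 1) \<omega>)))
    \<le> \<bar>s\<bar> * (2 * K * ergodic_coeff S (P n)) + s\<^sup>2 / 2 * (5 * K\<^sup>2 * mat_norm S (P n - Q))
      + \<bar>s\<bar> ^ 3 * (2 * K) ^ 3 / 6" (is "_ \<le> ?err")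
proof -
  let ?p = "row_pmf S Q i0"
  let ?row = "\<lambda>i. row_pmf S (P n) i"
  have Pn: "stochastic S (P n)" using n by (rule P_stochastic)
  have Qs: "stochastic S Q" using Q by (simp add: constant_stochastic_def)
  have K: "0 \<le> K" using h[of i0] by linarith
  have close: "\<bar>measure_pmf.expectation (?row i) u - measure_pmf.expectation ?p u\<bar>
      \<le> B * mat_norm S (P n - Q)" if i: "i \<in> S" and u: "\<And>j. \<bar>u j\<bar> \<le> B" for i u B
  proof -
    have "0 \<le> B" using u[of i0] by linarith
    have "Q i0 j = Q i j" if "j \<in> S" for j
      using Q i i0 that unfolding constant_stochastic_def by blast
    then have "(\<Sum>\<^sub>\<infinity>j\<in>S. \<bar>P n i j - Q i0 j\<bar>) = (\<Sum>\<^sub>\<infinity>j\<in>S. \<bar>P n i j - Q i j\<bar>)"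
      by (intro infsum_cong) simp
    also have "\<dots> \<le> mat_norm S (P n - Q)"
      by (rule row_diff_le_mat_norm[OF Pn Qs i])
    finally show ?thesis
      using expectation_row_pmf_diff[where h = u and C = B, OF Pn Qs i i0] u \<open>0 \<le> B\<close>
      by (meson mult_left_mono order_trans)
  qed
  have c: "\<bar>c n\<bar> \<le> K"
    unfolding c_def using norm_expectation_le[of "\<lambda>\<omega>. h (X n \<omega>)" K] h by simp
  have mean: "\<bar>c n - measure_pmf.expectation ?p h\<bar> \<le> K * mat_norm S (P n - Q)"
    unfolding c_def using close[OF _ h] by (intro expectation_X_near[OF n h])
  have near: "\<bar>measure_pmf.expectation (?row i) h - c n\<bar> \<le> 2 * K * ergodic_coeff S (P n)"
    if i: "i \<in> S" for i
  proof -
    have "\<bar>measure_pmf.expectation (?row k) h - measure_pmf.expectation (?row i) h\<bar>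
        \<le> 2 * K * ergodic_coeff S (P n)" if k: "k \<in> S" for k
      using expectation_row_pmf_diff[where h = h and C = K, OF Pn Pn k i] h K
        mult_left_mono[OF row_diff_le_ergodic_coeff[OF Pn k i] K] by simp
    from expectation_X_near[OF n h this] show ?thesis
      by (simp add: c_def abs_minus_commute)
  qed
  define b where "b = complex_of_real (1 - s\<^sup>2 * \<theta> / 2)"
  have row: "norm (measure_pmf.expectation (?row i) (\<lambda>j. iexp (s * (h j - c n))) - b) \<le> ?err"
    if i: "i \<in> S" for i
    unfolding b_def
    using norm_expectation_iexp_approx[OF h c near[OF i] mean close[OF i] \<theta>] by blast
  define W where "W = (\<lambda>xs. iexp (s * (\<Sum>k=1..n-1. h (xs ! k) - c k)))"
  have W: "W (hist n \<omega>) = iexp (s * T (n - 1) \<omega>)" for \<omega>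
    unfolding W_def T_def using n
    by (intro arg_cong[where f = "\<lambda>x. iexp (s * x)"] sum.cong) (auto simp: hist_def)
  have normW: "norm (W xs) = 1" for xs
    unfolding W_def by (simp flip: of_real_diff of_real_sum of_real_mult)
  have T_n: "T n \<omega> = T (n - 1) \<omega> + (h (X n \<omega>) - c n)" for \<omega>
    using n by (cases n) (auto simp: T_def)
  have split: "iexp (s * (x + y)) = iexp (s * x) * iexp (s * y)" for x y
    by (simp add: distrib_left exp_add)
  have hX[measurable]: "(\<lambda>\<omega>. h (X k \<omega>)) \<in> borel_measurable M" for k
    by (rule measurable_compose[OF X_borel]) simp
  have T_meas[measurable]: "T k \<in> borel_measurable M" for k
    unfolding T_def by measurable
  have int: "integrable M (\<lambda>\<omega>. iexp (s * T k \<omega>))" for k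
    by (intro integrable_const_bound[where B = 1]) auto
  have "expectation (\<lambda>\<omega>. iexp (s * T n \<omega>)) - b * expectation (\<lambda>\<omega>. iexp (s * T (n - 1) \<omega>))
      = expectation (\<lambda>\<omega>. iexp (s * T n \<omega>) - b * iexp (s * T (n - 1) \<omega>))"
    using int by simp
  also have "\<dots> = expectation (\<lambda>\<omega>. W (hist n \<omega>) * (iexp (s * (h (X n \<omega>) - c n)) - b))"
    unfolding W T_n split by (simp only: right_diff_distrib mult.commute)
  also have "\<dots> = expectation (\<lambda>\<omega>. measure_pmf.expectation (?row (X (n - 1) \<omega>))
      (\<lambda>j. W (hist n \<omega>) * (iexp (s * (h j - c n)) - b)))"
  proof (rule expectation_step[OF n])
    show "norm (W xs * (iexp (s * (h j - c n)) - b)) \<le> 1 + norm b" for xs j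
      using norm_triangle_ineq4[of "iexp (s * (h j - c n))" b] by (simp add: norm_mult normW)
  qed
  also have "norm \<dots> \<le> ?err"
  proof (intro norm_expectation_le AE_I2)
    fix \<omega> assume \<omega>: "\<omega> \<in> space M"
    have "integrable (measure_pmf (?row i)) (\<lambda>j. iexp (s * (h j - c n)))" for i
      by (rule integrable_pmf_bounded[where B = 1]) simp
    then have eq: "measure_pmf.expectation (?row (X (n - 1) \<omega>))
        (\<lambda>j. W (hist n \<omega>) * (iexp (s * (h j - c n)) - b))
      = W (hist n \<omega>) * (measure_pmf.expectation (?row (X (n - 1) \<omega>)) (\<lambda>j. iexp (s * (h j - c n))) - b)"
      by (simp add: integral_mult_right_zero)
    show "norm (measure_pmf.expectation (?row (X (n - 1) \<omega>))
        (\<lambda>j. W (hist n \<omega>) * (iexp (s * (h j - c n)) - b))) \<le> ?err"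
      unfolding eq norm_mult normW mult_1_left by (rule row[OF X_in_S[OF \<omega>]])
  qed
  finally show ?thesis
    unfolding b_def .
qed

text \<open>
  As the factor \<open>1 - s\<^sup>2 \<theta> / 2\<close> has modulus at most 1, the errors of the single steps are not amplified
  and just add up.
\<close>

lemma char_fun_approx:
  fixes h :: "'i \<Rightarrow> real"
  defines "c \<equiv> \<lambda>k. expectation (\<lambda>\<omega>. h (X k \<omega>))"
  defines "T \<equiv> \<lambda>n \<omega>. \<Sum>k=1..n. h (X k \<omega>) - c k"
  assumes Q: "constant_stochastic S Q" and i0: "i0 \<in> S" and h: "\<And>j. \<bar>h j\<bar> \<le> K"
    and \<theta>: "\<theta> = measure_pmf.expectation (row_pmf S Q i0) (\<lambda>j. (h j)\<^sup>2)
      - (measure_pmf.expectation (row_pmf S Q i0) h)\<^sup>2"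
    and s: "\<bar>1 - s\<^sup>2 * \<theta> / 2\<bar> \<le> 1"
  shows "norm (expectation (\<lambda>\<omega>. iexp (s * T n \<omega>)) - of_real ((1 - s\<^sup>2 * \<theta> / 2) ^ n))
    \<le> (\<Sum>k=1..n. \<bar>s\<bar> * (2 * K * ergodic_coeff S (P k)) + s\<^sup>2 / 2 * (5 * K\<^sup>2 * mat_norm S (P k - Q))
      + \<bar>s\<bar> ^ 3 * (2 * K) ^ 3 / 6)"
proof (induction n)
  case 0
  then show ?case by (simp add: T_def prob_space)
next
  case (Suc n)
  let ?E = "\<lambda>k. \<bar>s\<bar> * (2 * K * ergodic_coeff S (P k)) + s\<^sup>2 / 2 * (5 * K\<^sup>2 * mat_norm S (P k - Q))
      + \<bar>s\<bar> ^ 3 * (2 * K) ^ 3 / 6"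
  let ?b = "1 - s\<^sup>2 * \<theta> / 2" and ?a = "\<lambda>n. expectation (\<lambda>\<omega>. iexp (s * T n \<omega>))"
  have "?a (Suc n) - of_real (?b ^ Suc n)
      = (?a (Suc n) - of_real ?b * ?a n) + of_real ?b * (?a n - of_real (?b ^ n))"
    by (simp add: algebra_simps)
  then have "norm (?a (Suc n) - of_real (?b ^ Suc n))
      \<le> norm (?a (Suc n) - of_real ?b * ?a n) + norm (of_real ?b * (?a n - of_real (?b ^ n)))"
    by (simp only: norm_triangle_ineq)
  moreover have "norm (of_real ?b * (?a n - of_real (?b ^ n))) \<le> norm (?a n - of_real (?b ^ n))"
    using s by (simp only: norm_mult norm_of_real) (intro mult_left_le_one_le, auto)
  moreover have "norm (?a (Suc n) - of_real ?b * ?a n) \<le> ?E (Suc n)"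
    using char_fun_one_step[where h = h and n = "Suc n" and s = s, OF Q i0 h \<theta>]
    unfolding T_def c_def diff_Suc_1 by simp
  ultimately have "norm (?a (Suc n) - of_real (?b ^ Suc n)) \<le> ?E (Suc n) + norm (?a n - of_real (?b ^ n))"
    by linarith
  also have "\<dots> \<le> ?E (Suc n) + (\<Sum>k=1..n. ?E k)"
    by (rule add_left_mono) (rule Suc.IH)
  also have "\<dots> = (\<Sum>k=1..Suc n. ?E k)"
    by (rule sum.nat_ivl_Suc'[symmetric]) simp
  finally show ?case .
qed

section \<open>The central limit theorem for a limit with equal rows\<close>

text \<open>
  Summing the one-step errors with \<open>s = t / sqrt (n \<theta>)\<close> gives a constant times
  \<open>(\<Sum>k\<le>n. \<delta>(P\<^sub>k)) / sqrt n\<close>, a constant times the average of \<open>\<parallel>P\<^sub>k - Q\<parallel>\<close>, and a constant times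
  \<open>1 / sqrt n\<close>; all three tend to 0. Since the rows of \<open>Q\<close> agree, any index \<open>i0\<close> represents the
  limiting law.
\<close>

theorem clt_constant_limit:
  fixes h :: "'i \<Rightarrow> real"
  assumes Q: "constant_stochastic S Q" and i0: "i0 \<in> S" and h: "\<And>j. \<bar>h j\<bar> \<le> K"
    and \<theta>: "\<theta> = measure_pmf.expectation (row_pmf S Q i0) (\<lambda>j. (h j)\<^sup>2)
      - (measure_pmf.expectation (row_pmf S Q i0) h)\<^sup>2"
    and \<theta>_pos: "\<theta> > 0"
    and conv: "(\<lambda>n. (\<Sum>k=1..n. mat_norm S (P k - Q)) / real n) \<longlonglongrightarrow> 0"
    and delta: "(\<lambda>n. (\<Sum>k=1..n. ergodic_coeff S (P k)) / sqrt (real n)) \<longlonglongrightarrow> 0"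
  shows "weak_conv_m
    (\<lambda>n. distr M borel (\<lambda>\<omega>. ((\<Sum>k=1..n. h (X k \<omega>)) - expectation (\<lambda>\<omega>. \<Sum>k=1..n. h (X k \<omega>)))
      / sqrt (real n * \<theta>)))
    std_normal_distribution"
proof (rule levy_continuity)
  define c where "c = (\<lambda>k. expectation (\<lambda>\<omega>. h (X k \<omega>)))"
  define T where "T = (\<lambda>n \<omega>. \<Sum>k=1..n. h (X k \<omega>) - c k)"
  let ?D = "\<lambda>n. distr M borel (\<lambda>\<omega>. ((\<Sum>k=1..n. h (X k \<omega>))
      - expectation (\<lambda>\<omega>. \<Sum>k=1..n. h (X k \<omega>))) / sqrt (real n * \<theta>))"
  have [measurable]: "(\<lambda>\<omega>. h (X k \<omega>)) \<in> borel_measurable M" for k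
    by (rule measurable_compose[OF X_borel]) simp
  have centred: "(\<Sum>k=1..n. h (X k \<omega>)) - expectation (\<lambda>\<omega>. \<Sum>k=1..n. h (X k \<omega>)) = T n \<omega>" for n \<omega>
    using h by (simp add: T_def c_def sum_subtractf Bochner_Integration.integral_sum integrable_of_X[where B = K])
  show "real_distribution (?D n)" for n
    by simp
  show "real_distribution std_normal_distribution"
    by (rule real_dist_normal_dist)
  fix t :: real
  define s where "s = (\<lambda>n. t / sqrt (real n * \<theta>))"
  have char: "char (?D n) t = expectation (\<lambda>\<omega>. iexp (s n * T n \<omega>))" for n
    unfolding char_def centred using centred[symmetric]
    by (subst integral_distr) (auto simp: s_def)
  have s2: "(s n)\<^sup>2 * \<theta> = t\<^sup>2 / real n" for n
    using \<theta>_pos by (simp add: s_def power_divide)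
  define err where "err = (\<lambda>n. \<bar>t\<bar> / sqrt \<theta> * 2 * K * ((\<Sum>k=1..n. ergodic_coeff S (P k)) / sqrt (real n))
    + t\<^sup>2 / (2 * \<theta>) * 5 * K\<^sup>2 * ((\<Sum>k=1..n. mat_norm S (P k - Q)) / real n)
    + \<bar>t / sqrt \<theta>\<bar> ^ 3 * (2 * K) ^ 3 / 6 * (1 / sqrt (real n)))"
  have "(\<lambda>n. 1 / sqrt (real n)) \<longlonglongrightarrow> 0"
    by real_asymp
  then have "err \<longlonglongrightarrow> \<bar>t\<bar> / sqrt \<theta> * 2 * K * 0 + t\<^sup>2 / (2 * \<theta>) * 5 * K\<^sup>2 * 0
      + \<bar>t / sqrt \<theta>\<bar> ^ 3 * (2 * K) ^ 3 / 6 * 0"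
    unfolding err_def by (intro tendsto_intros conv delta)
  then have err: "err \<longlonglongrightarrow> 0"
    by simp
  \<comment> \<open>\<open>n \<ge> t\<^sup>2\<close> keeps the factor \<open>1 - t\<^sup>2 / (2 n)\<close> within modulus 1.\<close>
  have bound: "norm (char (?D n) t - of_real ((1 + (- t\<^sup>2 / 2) / real n) ^ n)) \<le> err n"
    if n: "real n \<ge> t\<^sup>2" "n \<ge> 1" for n
  proof -
    have "t\<^sup>2 / real n \<le> 1" using n by (simp add: divide_le_eq)
    moreover have "0 \<le> t\<^sup>2 / real n" by simp
    moreover have "\<bar>1 - x / 2\<bar> \<le> 1" if "x \<le> 1" "0 \<le> x" for x :: real
      using that by simp
    ultimately have le: "\<bar>1 - (s n)\<^sup>2 * \<theta> / 2\<bar> \<le> 1"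
      unfolding s2 by blast
    have eq: "1 + (- t\<^sup>2 / 2) / real n = 1 - (s n)\<^sup>2 * \<theta> / 2"
      by (simp add: s2)
    have "norm (char (?D n) t - of_real ((1 + (- t\<^sup>2 / 2) / real n) ^ n))
      \<le> (\<Sum>k=1..n. \<bar>s n\<bar> * (2 * K * ergodic_coeff S (P k)) + (s n)\<^sup>2 / 2 * (5 * K\<^sup>2 * mat_norm S (P k - Q))
      + \<bar>s n\<bar> ^ 3 * (2 * K) ^ 3 / 6)"
      unfolding char eq T_def c_def by (rule char_fun_approx[OF Q i0 h \<theta> le])
    also have "\<dots> = \<bar>s n\<bar> * 2 * K * (\<Sum>k=1..n. ergodic_coeff S (P k))
        + (s n)\<^sup>2 / 2 * 5 * K\<^sup>2 * (\<Sum>k=1..n. mat_norm S (P k - Q)) + real n * \<bar>s n\<bar> ^ 3 * (2 * K) ^ 3 / 6"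
      by (simp add: sum.distrib sum_distrib_left mult.assoc)
    also have "\<dots> = err n"
    proof -
      have abs_s: "\<bar>s n\<bar> = \<bar>t\<bar> / sqrt \<theta> / sqrt (real n)"
        using \<theta>_pos by (simp add: s_def real_sqrt_mult abs_mult)
      have sq: "(s n)\<^sup>2 = t\<^sup>2 / \<theta> / real n"
      proof -
        have "(s n)\<^sup>2 = (s n)\<^sup>2 * \<theta> / \<theta>" using \<theta>_pos by simp
        also have "\<dots> = t\<^sup>2 / \<theta> / real n" unfolding s2 by simp
        finally show ?thesis .
      qed
      have cube: "real n * \<bar>s n\<bar> ^ 3 = \<bar>t / sqrt \<theta>\<bar> ^ 3 * (1 / sqrt (real n))"
      proof -
        have "sqrt (real n) ^ 3 = real n * sqrt (real n)"
          by (simp add: power3_eq_cube)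
        then have pow: "real n * (a / sqrt (real n)) ^ 3 = a ^ 3 * (1 / sqrt (real n))" for a
          using n by (simp add: power_divide)
        have abs_t: "\<bar>t / sqrt \<theta>\<bar> = \<bar>t\<bar> / sqrt \<theta>"
          using \<theta>_pos by simp
        show ?thesis
          unfolding abs_s abs_t by (rule pow)
      qed
      show ?thesis
        unfolding err_def cube unfolding abs_s sq by simp
    qed
    finally show ?thesis .
  qed
  have ev: "\<forall>\<^sub>F n in sequentially. norm (char (?D n) t - of_real ((1 + (- t\<^sup>2 / 2) / real n) ^ n)) \<le> err n"
    using eventually_ge_at_top[of "nat \<lceil>t\<^sup>2\<rceil>"] eventually_ge_at_top[of 1]
    by eventually_elim (rule bound; linarith)
  have "(\<lambda>n. char (?D n) t - of_real ((1 + (- t\<^sup>2 / 2) / real n) ^ n)) \<longlonglongrightarrow> 0"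
    by (rule Lim_null_comparison[OF ev err])
  then have "(\<lambda>n. char (?D n) t - of_real ((1 + (- t\<^sup>2 / 2) / real n) ^ n)
      + of_real ((1 + (- t\<^sup>2 / 2) / real n) ^ n)) \<longlonglongrightarrow> 0 + complex_of_real (exp (- t\<^sup>2 / 2))"
  proof (rule tendsto_add)
    show "(\<lambda>n. complex_of_real ((1 + (- t\<^sup>2 / 2) / real n) ^ n)) \<longlonglongrightarrow> of_real (exp (- t\<^sup>2 / 2))"
      by (intro tendsto_of_real tendsto_exp_limit_sequentially)
  qed
  then show "(\<lambda>n. char (?D n) t) \<longlonglongrightarrow> char std_normal_distribution t"
    unfolding char_std_normal_distribution diff_add_cancel add_0_left by simp
qed

section \<open>Vanishing ergodic coefficients force equal rows\<close>

text \<open>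
  Two rows of \<open>Q\<close> are compared through the corresponding rows of \<open>P k\<close>. Averaging over \<open>k \<le> n\<close>
  leaves a bound that tends to 0: the average of the coefficients is \<open>1 / sqrt n\<close> times the sequence
  \<open>(\<Sum>k\<le>n. \<delta>(P\<^sub>k)) / sqrt n\<close>.
\<close>

lemma limit_rows_equal:
  assumes Q: "stochastic S Q"
    and conv: "(\<lambda>n. (\<Sum>k=1..n. mat_norm S (P k - Q)) / real n) \<longlonglongrightarrow> 0"
    and delta: "(\<lambda>n. (\<Sum>k=1..n. ergodic_coeff S (P k)) / sqrt (real n)) \<longlonglongrightarrow> 0"
  shows "constant_stochastic S Q"
proof -
  have "Q i j = Q l j" if i: "i \<in> S" and l: "l \<in> S" and j: "j \<in> S" for i l j
  proof -
    let ?\<epsilon> = "\<lambda>k. mat_norm S (P k - Q)" and ?\<delta> = "\<lambda>k. ergodic_coeff S (P k)"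
    have entry: "\<bar>A i j - B k j\<bar> \<le> (\<Sum>\<^sub>\<infinity>j\<in>S. \<bar>A i j - B k j\<bar>)"
      if "stochastic S A" "stochastic S B" "i \<in> S" "k \<in> S" for A B i k
      using infsum_mono_neutral[of "\<lambda>j. \<bar>A i j - B k j\<bar>" "{j}" "\<lambda>j. \<bar>A i j - B k j\<bar>" S]
        summable_row_diff[OF that] j by simp
    have step: "\<bar>Q i j - Q l j\<bar> \<le> 2 * ?\<epsilon> k + 2 * ?\<delta> k" if k: "k \<ge> 1" for k
      using entry[OF P_stochastic[OF k] Q i i] entry[OF P_stochastic[OF k] Q l l]
        entry[OF P_stochastic[OF k] P_stochastic[OF k] i l]
        row_diff_le_mat_norm[OF P_stochastic[OF k] Q i] row_diff_le_mat_norm[OF P_stochastic[OF k] Q l]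
        row_diff_le_ergodic_coeff[OF P_stochastic[OF k] i l]
      by linarith
    have bound: "\<bar>Q i j - Q l j\<bar> \<le> 2 * ((\<Sum>k=1..n. ?\<epsilon> k) / real n)
        + 2 * ((\<Sum>k=1..n. ?\<delta> k) / sqrt (real n)) * (1 / sqrt (real n))" if n: "n \<ge> 1" for n
    proof -
      have "real n * \<bar>Q i j - Q l j\<bar> = (\<Sum>k=1..n. \<bar>Q i j - Q l j\<bar>)"
        by simp
      also have "\<dots> \<le> (\<Sum>k=1..n. 2 * ?\<epsilon> k + 2 * ?\<delta> k)"
        by (intro sum_mono step) auto
      also have "\<dots> = 2 * (\<Sum>k=1..n. ?\<epsilon> k) + 2 * (\<Sum>k=1..n. ?\<delta> k)"
        by (simp only: sum.distrib sum_distrib_left)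
      finally have "\<bar>Q i j - Q l j\<bar> \<le> (2 * (\<Sum>k=1..n. ?\<epsilon> k) + 2 * (\<Sum>k=1..n. ?\<delta> k)) / real n"
        using n by (simp only: pos_le_divide_eq mult.commute of_nat_0_less_iff)
      also have "\<dots> = 2 * ((\<Sum>k=1..n. ?\<epsilon> k) / real n)
          + 2 * ((\<Sum>k=1..n. ?\<delta> k) / sqrt (real n)) * (1 / sqrt (real n))"
        by (simp add: add_divide_distrib)
      finally show ?thesis .
    qed
    have "(\<lambda>n. 1 / sqrt (real n)) \<longlonglongrightarrow> 0"
      by real_asymp
    then have "(\<lambda>n. 2 * ((\<Sum>k=1..n. ?\<epsilon> k) / real n)
        + 2 * ((\<Sum>k=1..n. ?\<delta> k) / sqrt (real n)) * (1 / sqrt (real n))) \<longlonglongrightarrow> 2 * 0 + 2 * 0 * 0"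
      by (intro tendsto_intros conv delta)
    then have "\<bar>Q i j - Q l j\<bar> \<le> 2 * 0 + 2 * 0 * 0"
      using bound by (intro LIMSEQ_le_const) auto
    then show ?thesis by simp
  qed
  then show ?thesis
    using Q unfolding constant_stochastic_def by blast
qed

end

section \<open>The central limit theorem\<close>

theorem theorem1p1:
  fixes M :: "'a measure"
    and S :: "nat set"
    and X :: "nat \<Rightarrow> 'a \<Rightarrow> nat"
    and \<mu> :: "nat \<Rightarrow> real"
    and Pn :: "nat \<Rightarrow> nat \<Rightarrow> nat \<Rightarrow> real"
    and f :: "real \<Rightarrow> real"
    and K :: real
    and P R :: "nat \<Rightarrow> nat \<Rightarrow> real"
    and \<pi> :: "nat \<Rightarrow> real"
    and \<theta> :: real
    and Sn :: "nat \<Rightarrow> 'a \<Rightarrow> real"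
  assumes S: "S = {1..}"
    and chain: "nonhom_markov_chain M S X \<mu> Pn"
    and f_bounded: "\<And>x. \<bar>f x\<bar> \<le> K"
    and P: "periodic_strongly_ergodic S P"
    and R: "constant_stochastic S R"
    and R_rows: "\<And>i j. i \<in> S \<Longrightarrow> j \<in> S \<Longrightarrow> R i j = \<pi> j"
    and \<pi>_eigen: "\<And>j. j \<in> S \<Longrightarrow> ((\<lambda>i. \<pi> i * P i j) has_sum \<pi> j) S"
    and \<pi>_sum: "(\<pi> has_sum 1) S"
    and Pn_conv:
      "(\<lambda>n. SUP m. 1 / real n * (\<Sum>k=1..n. mat_norm S (Pn (k + m) - P))) \<longlonglongrightarrow> 0"
    and \<theta>: "\<theta> = (\<Sum>\<^sub>\<infinity>i\<in>S. \<pi> i * ((f (real i))\<^sup>2 - (\<Sum>\<^sub>\<infinity>j\<in>S. f (real j) * P i j)\<^sup>2))"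
    and \<theta>_pos: "\<theta> > 0"
    and delta: "(\<lambda>n. (\<Sum>k=1..n. ergodic_coeff S (Pn k)) / sqrt (real n)) \<longlonglongrightarrow> 0"
    and Sn: "\<And>n \<omega>. Sn n \<omega> = (\<Sum>k=1..n. f (real (X k \<omega>)))"
  shows "weak_conv_m
    (\<lambda>n. distr M borel
      (\<lambda>\<omega>. (Sn n \<omega> - prob_space.expectation M (Sn n)) / sqrt (real n * \<theta>)))
    std_normal_distribution"
proof -
  interpret nonhom_markov_chain M S X \<mu> Pn by (rule chain)
  have P_st: "stochastic S P"
    using P by (simp add: periodic_strongly_ergodic_def)
  have ne: "S \<noteq> {}" using S by auto
  then obtain i0 where i0: "i0 \<in> S" by auto
  note bounds = mat_norm_diff_bounds[OF P_stochastic P_st ne]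
  \<comment> \<open>The shift \<open>m = 0\<close> is below the supremum, which is taken over numbers at most 2.\<close>
  have conv: "(\<lambda>n. (\<Sum>k=1..n. mat_norm S (Pn k - P)) / real n) \<longlonglongrightarrow> 0"
  proof (rule tendsto_sandwich[OF _ _ tendsto_const Pn_conv])
    show "\<forall>\<^sub>F n in sequentially. 0 \<le> (\<Sum>k=1..n. mat_norm S (Pn k - P)) / real n"
      using bounds(1) by (intro always_eventually allI divide_nonneg_nonneg sum_nonneg) auto
    have "(\<Sum>k=1..n. mat_norm S (Pn k - P)) / real n
        \<le> (SUP m. 1 / real n * (\<Sum>k=1..n. mat_norm S (Pn (k + m) - P)))" for n
    proof (rule cSUP_upper2[where x = 0])
      show "bdd_above (range (\<lambda>m. 1 / real n * (\<Sum>k=1..n. mat_norm S (Pn (k + m) - P))))"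
      proof (intro bdd_aboveI2)
        fix m
        have "(\<Sum>k=1..n. mat_norm S (Pn (k + m) - P)) \<le> (\<Sum>k=1..n. 2)"
          using bounds(2) by (intro sum_mono) auto
        then show "1 / real n * (\<Sum>k=1..n. mat_norm S (Pn (k + m) - P)) \<le> 1 / real n * (\<Sum>k=1..n. 2)"
          by (rule mult_left_mono) simp
      qed
    qed auto
    then show "\<forall>\<^sub>F n in sequentially. (\<Sum>k=1..n. mat_norm S (Pn k - P)) / real n
        \<le> (SUP m. 1 / real n * (\<Sum>k=1..n. mat_norm S (Pn (k + m) - P)))"
      by (intro always_eventually allI)
  qed
  have const: "constant_stochastic S P"
    by (rule limit_rows_equal[OF P_st conv delta])
  \<comment> \<open>As the rows of \<open>P\<close> agree, \<open>\<pi> P\<close> is their common value times the total mass 1 of \<open>\<pi>\<close>.\<close>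
  have P_rows: "P i j = \<pi> j" if i: "i \<in> S" and j: "j \<in> S" for i j
  proof -
    have "((\<lambda>k. \<pi> k * P i j) has_sum 1 * P i j) S"
      using \<pi>_sum by (rule has_sum_cmult_left)
    also have "?this \<longleftrightarrow> ((\<lambda>k. \<pi> k * P k j) has_sum 1 * P i j) S"
      using const i j unfolding constant_stochastic_def by (intro has_sum_cong) metis
    finally show ?thesis
      using \<pi>_eigen[OF j] has_sum_unique by fastforce
  qed
  let ?h = "\<lambda>j. f (real j)" and ?p = "row_pmf S P i0"
  have h2: "\<bar>(?h j)\<^sup>2\<bar> \<le> K\<^sup>2" for j
    using f_bounded[of "real j"] by (simp add: abs_le_square_iff[symmetric])
  have sum_h2: "((\<lambda>j. \<pi> j * (?h j)\<^sup>2) has_sum measure_pmf.expectation ?p (\<lambda>j. (?h j)\<^sup>2)) S"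
    using expectation_row_pmf_has_sum[OF P_st i0 h2] 
    by (rule has_sum_cong[THEN iffD1, rotated]) (simp add: P_rows i0 mult.commute)
  let ?m = "measure_pmf.expectation ?p ?h"
  have mean: "(\<Sum>\<^sub>\<infinity>j\<in>S. f (real j) * P i j) = ?m" if i: "i \<in> S" for i
  proof (rule infsumI)
    show "((\<lambda>j. f (real j) * P i j) has_sum ?m) S"
      using expectation_row_pmf_has_sum[where h = ?h, OF P_st i0 f_bounded]
      by (rule has_sum_cong[THEN iffD1, rotated]) (simp add: P_rows i0 i)
  qed
  have "((\<lambda>i. - (\<pi> i * ?m\<^sup>2)) has_sum - (1 * ?m\<^sup>2)) S"
    unfolding has_sum_uminus minus_minus by (rule has_sum_cmult_left[OF \<pi>_sum])
  from has_sum_add[OF sum_h2 this]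
  have "((\<lambda>i. \<pi> i * ((?h i)\<^sup>2 - (\<Sum>\<^sub>\<infinity>j\<in>S. f (real j) * P i j)\<^sup>2)) has_sum
      measure_pmf.expectation ?p (\<lambda>j. (?h j)\<^sup>2) + - (1 * ?m\<^sup>2)) S"
    by (rule has_sum_cong[THEN iffD1, rotated]) (simp add: mean right_diff_distrib)
  then have \<theta>_eq: "\<theta> = measure_pmf.expectation ?p (\<lambda>j. (?h j)\<^sup>2) - (measure_pmf.expectation ?p ?h)\<^sup>2"
    unfolding \<theta> by (simp add: infsumI)
  have "Sn n = (\<lambda>\<omega>. \<Sum>k=1..n. ?h (X k \<omega>))" for n
    by (auto simp: Sn)
  then show ?thesis
    using clt_constant_limit[where h = ?h, OF const i0 f_bounded \<theta>_eq \<theta>_pos conv delta] by simp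
qed

end
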